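(* Let $\mathfrak{f}\in\mathbb{Z}_p[T]$ be a random $p$-adic polynomial of degree $d$. Then, for every $x\in\mathbb{Z}_p$ and $s\ge0$, $\mathbb{P}(\kappa(\mathfrak{f},x)\ge p^s)\le p^{-2s}$, and, for every $s\ge0$, $\mathbb{P}(\kappa(\mathfrak{f})\ge p^s)\le p^{-s}$.
   Context: A random $p$-adic polynomial of degree $d$ is $\mathfrak{f}=\sum_{k=0}^d\mathfrak{f}_kT^k$ with the $\mathfrak{f}_k$ independent and uniformly distributed in $\mathbb{Z}_p$ with respect to the Haar probability measure. $|\cdot|$ is the $p$-adic absolute value, $\|f\|:=\max_k|f_k|$, $\kappa(f,x):=\|f\|/\max\{|f(x)|,|f'(x)|\}\in(0,\infty]$ and $\kappa(f):=\sup_{z\in\mathbb{Z}_p}\kappa(f,z)$. *)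

theory Defs
  imports "HOL-Probability.Probability" "Berlekamp_Zassenhaus.Finite_Field"
begin

section \<open>The ring of $p$-adic integers\<close>

text \<open>
  The prime $p$ is \<^term>\<open>CARD('p)\<close> for a type \<^typ>\<open>'p::prime_card\<close>. A $p$-adic integer is an
  element of the inverse limit of the rings $Z/p^n$, each residue class being represented by
  its least nonnegative element (this is the case \<open>m = n\<close> of the condition).
\<close>

typedef (overloaded) ('p::prime_card) padic_int =
  "{x :: nat \<Rightarrow> int. \<forall>m n. m \<le> n \<longrightarrow> x n mod int CARD('p) ^ m = x m}"
  morphisms residue Abs_padic_int
  by (rule exI[of _ "\<lambda>_. 0"]) simp

setup_lifting type_definition_padic_int

lemma mod_power_mod_power:
  fixes q a :: int
  assumes "m \<le> n"
  shows "a mod q ^ n mod q ^ m = a mod q ^ m"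
  using assms by (simp add: mod_mod_cancel le_imp_power_dvd)

lemma residue_mod:
  "m \<le> n \<Longrightarrow> residue (x :: 'p::prime_card padic_int) n mod int CARD('p) ^ m = residue x m"
  using residue[of x] by blast

lemma padic_int_eqI: "(\<And>n. residue x n = residue y n) \<Longrightarrow> x = y"
  by (metis ext residue_inject)

lemma prime_gt_1_card: "1 < CARD('p::prime_card)"
  using prime_card[where 'a='p] prime_gt_1_nat by blast

instantiation padic_int :: (prime_card) comm_ring_1
begin

lift_definition zero_padic_int :: "'a padic_int" is "\<lambda>_. 0" by simp

lift_definition one_padic_int :: "'a padic_int" is "\<lambda>n. 1 mod int CARD('a) ^ n"
  by (simp add: mod_power_mod_power)

lift_definition plus_padic_int :: "'a padic_int \<Rightarrow> 'a padic_int \<Rightarrow> 'a padic_int"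
  is "\<lambda>x y n. (x n + y n) mod int CARD('a) ^ n"
  by (simp add: mod_power_mod_power) (metis mod_add_eq)

lift_definition minus_padic_int :: "'a padic_int \<Rightarrow> 'a padic_int \<Rightarrow> 'a padic_int"
  is "\<lambda>x y n. (x n - y n) mod int CARD('a) ^ n"
  by (simp add: mod_power_mod_power) (metis mod_diff_eq)

lift_definition uminus_padic_int :: "'a padic_int \<Rightarrow> 'a padic_int"
  is "\<lambda>x n. (- x n) mod int CARD('a) ^ n"
  by (simp add: mod_power_mod_power) (metis mod_minus_eq)

lift_definition times_padic_int :: "'a padic_int \<Rightarrow> 'a padic_int \<Rightarrow> 'a padic_int"
  is "\<lambda>x y n. (x n * y n) mod int CARD('a) ^ n"
  by (simp add: mod_power_mod_power) (metis mod_mult_eq)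

instance
proof
  fix a b c :: "'a padic_int"
  note defs = zero_padic_int.rep_eq one_padic_int.rep_eq plus_padic_int.rep_eq
    minus_padic_int.rep_eq uminus_padic_int.rep_eq times_padic_int.rep_eq
  note r = residue_mod[OF order_refl]
  show "a * b * c = a * (b * c)"
    by (rule padic_int_eqI) (simp add: defs mod_simps mult.assoc)
  show "a * b = b * a"
    by (rule padic_int_eqI) (simp add: defs mult.commute)
  show "1 * a = a"
    by (rule padic_int_eqI) (simp add: defs mod_simps r)
  show "a + b + c = a + (b + c)"
    by (rule padic_int_eqI) (simp add: defs mod_simps add.assoc)
  show "a + b = b + a"
    by (rule padic_int_eqI) (simp add: defs add.commute)
  show "0 + a = a"
    by (rule padic_int_eqI) (simp add: defs r)
  show "- a + a = 0"
    by (rule padic_int_eqI) (simp add: defs mod_simps)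
  show "a - b = a + - b"
    by (rule padic_int_eqI) (simp add: defs mod_simps)
  show "(a + b) * c = a * c + b * c"
    by (rule padic_int_eqI) (simp add: defs mod_simps distrib_right)
  have "residue (0 :: 'a padic_int) 1 \<noteq> residue 1 1"
    using prime_gt_1_card[where 'p='a] by (simp add: defs)
  then show "(0 :: 'a padic_int) \<noteq> 1" by metis
qed

end

lemma residue_mod_self [simp]:
  "residue (x :: 'p::prime_card padic_int) n mod int CARD('p) ^ n = residue x n"
  by (rule residue_mod) simp

lemma residue_eq_0_iff:
  "residue (x :: 'p::prime_card padic_int) n = 0 \<longleftrightarrow> int CARD('p) ^ n dvd residue x n"
  by (metis dvd_eq_mod_eq_0 residue_mod_self)

lemma residue_eq_0_iff':
  assumes "n \<le> m"
  shows "residue (x :: 'p::prime_card padic_int) n = 0 \<longleftrightarrow> int CARD('p) ^ n dvd residue x m"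
  by (metis assms dvd_eq_mod_eq_0 residue_mod)

instance padic_int :: (prime_card) idom
proof
  fix x y :: "'a padic_int"
  let ?q = "int CARD('a)"
  have q: "prime ?q" by (rule prime_card_int)
  assume "x \<noteq> 0" "y \<noteq> 0"
  then obtain n m where nm: "residue x n \<noteq> 0" "residue y m \<noteq> 0"
    by (metis padic_int_eqI zero_padic_int.rep_eq)
  let ?a = "residue x (n + m)" and ?b = "residue y (n + m)"
  have nd: "\<not> ?q ^ n dvd ?a" "\<not> ?q ^ m dvd ?b"
    using nm residue_eq_0_iff'[of n "n + m" x] residue_eq_0_iff'[of m "n + m" y] by auto
  then have nz: "?a \<noteq> 0" "?b \<noteq> 0" by auto
  have "multiplicity ?q ?a < n" "multiplicity ?q ?b < m"
    using nd multiplicity_dvd' not_less by blast+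
  then have "multiplicity ?q (?a * ?b) < n + m"
    using q nz by (simp add: prime_elem_multiplicity_mult_distrib)
  then have "\<not> ?q ^ (n + m) dvd ?a * ?b"
    using q nz by (metis multiplicity_geI mult_eq_0_iff not_less not_prime_unit)
  then have "residue (x * y) (n + m) \<noteq> 0"
    by (simp add: times_padic_int.rep_eq dvd_eq_mod_eq_0)
  then show "x * y \<noteq> 0" by (metis zero_padic_int.rep_eq)
qed

lemma residue_of_nat: "residue (of_nat k :: 'p::prime_card padic_int) n = int k mod int CARD('p) ^ n"
proof (induction k)
  case 0
  then show ?case by (simp add: zero_padic_int.rep_eq)
next
  case (Suc k)
  then show ?case
    by (simp add: plus_padic_int.rep_eq one_padic_int.rep_eq mod_simps)
qed

lemma power_dvd_iff_residue:
  "(of_nat CARD('p) :: 'p::prime_card padic_int) ^ n dvd x \<longleftrightarrow> residue x n = 0"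
proof -
  let ?q = "int CARD('p)"
  have q: "?q > 0" using prime_gt_1_card[where 'p='p] by simp
  have r: "residue ((of_nat CARD('p) :: 'p padic_int) ^ n) k = ?q ^ n mod ?q ^ k" for k
    using residue_of_nat[of "CARD('p) ^ n" k, where 'p='p] by simp
  show ?thesis
  proof
    assume "(of_nat CARD('p) :: 'p padic_int) ^ n dvd x"
    then obtain y where "x = of_nat CARD('p) ^ n * y" ..
    then show "residue x n = 0" by (simp add: times_padic_int.rep_eq r)
  next
    assume x: "residue x n = 0"
    define y where "y k = residue x (n + k) div ?q ^ n" for k
    have xy: "residue x (n + k) = ?q ^ n * y k" for k
      using x residue_eq_0_iff'[of n "n + k" x] by (simp add: y_def)
    have "y k mod ?q ^ j = y j" if "j \<le> k" for j k
    proof -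
      have "?q ^ n * (y k mod ?q ^ j) = residue x (n + k) mod ?q ^ (n + j)"
        unfolding xy power_add by (rule mult_mod_right)
      also have "\<dots> = ?q ^ n * y j"
        using that residue_mod[of "n + j" "n + k" x] xy by simp
      finally show ?thesis using q by simp
    qed
    then have y: "residue (Abs_padic_int y :: 'p padic_int) = y"
      by (intro Abs_padic_int_inverse) auto
    have "x = of_nat CARD('p) ^ n * Abs_padic_int y"
    proof (rule padic_int_eqI)
      fix k
      have "residue (of_nat CARD('p) ^ n * Abs_padic_int y :: 'p padic_int) k
          = residue x (n + k) mod ?q ^ k"
        by (simp add: times_padic_int.rep_eq r y xy mod_simps)
      then show "residue x k = residue (of_nat CARD('p) ^ n * Abs_padic_int y :: 'p padic_int) k"
        by (simp add: residue_mod)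
    qed
    then show "(of_nat CARD('p) :: 'p padic_int) ^ n dvd x" by simp
  qed
qed

section \<open>The $p$-adic absolute value\<close>

definition padic_val :: "'p::prime_card padic_int \<Rightarrow> nat"
  where "padic_val x = Max {n. of_nat CARD('p) ^ n dvd x}"

definition padic_abs :: "'p::prime_card padic_int \<Rightarrow> real"
  where "padic_abs x = (if x = 0 then 0 else 1 / real CARD('p) ^ padic_val x)"

lemma power_dvd_iff_padic_val:
  fixes x :: "'p::prime_card padic_int"
  assumes "x \<noteq> 0"
  shows "of_nat CARD('p) ^ n dvd x \<longleftrightarrow> n \<le> padic_val x"
proof -
  let ?S = "{n. (of_nat CARD('p) :: 'p padic_int) ^ n dvd x}"
  obtain m where m: "residue x m \<noteq> 0"
    by (metis assms padic_int_eqI zero_padic_int.rep_eq)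
  have dc: "j \<in> ?S" if "k \<in> ?S" "j \<le> k" for j k
    using that by (auto intro: power_le_dvd)
  have "?S \<subseteq> {..m}"
    using dc m by (metis atMost_iff linorder_le_cases mem_Collect_eq power_dvd_iff_residue subsetI)
  then have fin: "finite ?S" using finite_subset by blast
  have "0 \<in> ?S" by simp
  then have "Max ?S \<in> ?S" using fin Max_in by blast
  then show ?thesis
    unfolding padic_val_def using dc fin Max_ge by blast
qed

lemma padic_abs_le_iff:
  fixes x :: "'p::prime_card padic_int"
  shows "padic_abs x \<le> 1 / real CARD('p) ^ n \<longleftrightarrow> residue x n = 0"
proof (cases "x = 0")
  case True
  then show ?thesis by (simp add: padic_abs_def zero_padic_int.rep_eq)
next
  case False
  have p: "1 < real CARD('p)" using prime_gt_1_card[where 'p='p] by simp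
  have "padic_abs x \<le> 1 / real CARD('p) ^ n \<longleftrightarrow> n \<le> padic_val x"
    using False p by (simp add: padic_abs_def divide_simps power_increasing_iff)
  then show ?thesis
    using False by (simp add: power_dvd_iff_padic_val flip: power_dvd_iff_residue)
qed

lemma residue_minus_eq_0_iff:
  fixes x :: "'p::prime_card padic_int"
  shows "residue (x - y) n = 0 \<longleftrightarrow> residue x n = residue y n"
  by (metis minus_padic_int.rep_eq mod_eq_dvd_iff dvd_eq_mod_eq_0 residue_mod_self)

instantiation padic_int :: (prime_card) metric_space
begin

definition dist_padic_int :: "'a padic_int \<Rightarrow> 'a padic_int \<Rightarrow> real"
  where "dist x y = padic_abs (x - y)"

definition uniformity_padic_int :: "('a padic_int \<times> 'a padic_int) filter"
  where "uniformity = (INF e\<in>{0 <..}. principal {(x :: 'a padic_int, y). dist x y < e})"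

definition open_padic_int :: "'a padic_int set \<Rightarrow> bool"
  where "open (U :: 'a padic_int set) \<longleftrightarrow> (\<forall>x\<in>U. eventually (\<lambda>(x', y). x' = x \<longrightarrow> y \<in> U) uniformity)"

instance
proof
  fix x y z :: "'a padic_int"
  have nn: "padic_abs u \<ge> 0" for u :: "'a padic_int"
    by (simp add: padic_abs_def)
  have n0: "padic_abs u = 0 \<longleftrightarrow> u = 0" for u :: "'a padic_int"
    using prime_gt_1_card[where 'p='a] by (simp add: padic_abs_def)
  show "dist x y = 0 \<longleftrightarrow> x = y" by (simp add: dist_padic_int_def n0)
  have tri: "padic_abs (x - y) \<le> padic_abs u"
    if "u \<noteq> 0" "padic_abs (x - z) \<le> padic_abs u" "padic_abs (y - z) \<le> padic_abs u" for u :: "'a padic_int"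
  proof -
    have u: "padic_abs u = 1 / real CARD('a) ^ padic_val u"
      using that by (simp add: padic_abs_def)
    show ?thesis
      using that(2,3) unfolding u padic_abs_le_iff residue_minus_eq_0_iff by simp
  qed
  show "dist x y \<le> dist x z + dist y z"
  proof (cases "padic_abs (x - z) \<le> padic_abs (y - z)")
    case le: True
    show ?thesis
    proof (cases "y = z")
      case True
      then have "x = z" using le nn[of "x - z"] n0[of "x - z"] n0[of 0] by simp
      with True show ?thesis by (simp add: dist_padic_int_def nn)
    next
      case False
      then have "padic_abs (x - y) \<le> padic_abs (y - z)" by (intro tri le) simp_all
      then show ?thesis using nn[of "x - z"] unfolding dist_padic_int_def by linarith
    qed
  next
    case False
    then have "x - z \<noteq> 0" using nn[of "y - z"] n0[of "x - z"] by linarith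
    then have "padic_abs (x - y) \<le> padic_abs (x - z)" using False by (intro tri) simp_all
    then show ?thesis using nn[of "y - z"] unfolding dist_padic_int_def by linarith
  qed
qed (simp_all add: uniformity_padic_int_def open_padic_int_def)

end

section \<open>Haar measure\<close>

text \<open>
  Every Borel probability measure on a compact metrizable group is regular, so regularity
  need not be part of the definition.
\<close>

definition haar_prob :: "'p::prime_card padic_int measure \<Rightarrow> bool"
  where "haar_prob \<mu> \<longleftrightarrow> prob_space \<mu> \<and> sets \<mu> = sets borel \<and>
    (\<forall>a. \<forall>A\<in>sets borel. emeasure \<mu> ((\<lambda>x. a + x) ` A) = emeasure \<mu> A)"

lemma dist_padic_le_iff:
  "dist x y \<le> 1 / real CARD('p) ^ n \<longleftrightarrow> residue x n = residue (y :: 'p::prime_card padic_int) n"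
  by (simp add: dist_padic_int_def padic_abs_le_iff residue_minus_eq_0_iff)

lemma open_padic_iff:
  fixes U :: "'p::prime_card padic_int set"
  shows "open U \<longleftrightarrow> (\<forall>x\<in>U. \<exists>n. \<forall>y. residue y n = residue x n \<longrightarrow> y \<in> U)"
proof -
  have p: "1 < real CARD('p)" using prime_gt_1_card[where 'p='p] by simp
  have "(\<exists>e>0. \<forall>y. dist y x < e \<longrightarrow> y \<in> U) \<longleftrightarrow> (\<exists>n. \<forall>y. residue y n = residue x n \<longrightarrow> y \<in> U)" for x
  proof
    assume "\<exists>e>0. \<forall>y. dist y x < e \<longrightarrow> y \<in> U"
    then obtain e where e: "e > 0" "\<And>y. dist y x < e \<Longrightarrow> y \<in> U" by blast
    obtain n where "(1 / real CARD('p)) ^ n < e"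
      using real_arch_pow_inv[OF e(1), of "1 / real CARD('p)"] p by auto
    then have n: "1 / real CARD('p) ^ n < e" by (simp add: power_one_over)
    then show "\<exists>n. \<forall>y. residue y n = residue x n \<longrightarrow> y \<in> U"
      using e(2) le_less_trans[OF _ n] dist_padic_le_iff by blast
  next
    assume "\<exists>n. \<forall>y. residue y n = residue x n \<longrightarrow> y \<in> U"
    then obtain n where n: "\<And>y. residue y n = residue x n \<Longrightarrow> y \<in> U" by blast
    show "\<exists>e>0. \<forall>y. dist y x < e \<longrightarrow> y \<in> U"
    proof (intro exI conjI allI impI)
      show "1 / real CARD('p) ^ n > 0" using p by simp
      fix y assume "dist y x < 1 / real CARD('p) ^ n"
      then show "y \<in> U" using n dist_padic_le_iff less_imp_le by blast
    qed
  qed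
  then show ?thesis by (simp add: open_dist)
qed

definition residue_class :: "nat \<Rightarrow> int \<Rightarrow> 'p::prime_card padic_int set"
  where "residue_class n r = {x. residue x n = r}"

lemma open_residue_class: "open (residue_class n r)"
  unfolding open_padic_iff residue_class_def by auto

lemma residue_nonneg: "0 \<le> residue (x :: 'p::prime_card padic_int) n"
  and residue_less: "residue x n < int CARD('p) ^ n"
proof -
  have "0 < int CARD('p) ^ n" using prime_gt_1_card[where 'p='p] by simp
  then show "0 \<le> residue x n" "residue x n < int CARD('p) ^ n"
    by (metis pos_mod_sign residue_mod_self, metis pos_mod_bound residue_mod_self)
qed

lemma residue_class_empty:
  "r \<notin> {0..<int CARD('p) ^ n} \<Longrightarrow> (residue_class n r :: 'p::prime_card padic_int set) = {}"
  using residue_nonneg residue_less by (auto simp: residue_class_def)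

lemma borel_padic_eq_sigma:
  "(borel :: 'p::prime_card padic_int measure) = sigma UNIV (range (case_prod residue_class))"
proof (rule borel_eq_countable_basis)
  show "topological_basis (range (case_prod residue_class) :: 'p padic_int set set)"
  proof (rule topological_basisI)
    fix U :: "'p padic_int set" and x
    assume "open U" "x \<in> U"
    then obtain n where "\<And>y. residue y n = residue x n \<Longrightarrow> y \<in> U"
      unfolding open_padic_iff by blast
    then show "\<exists>B\<in>range (case_prod residue_class). x \<in> B \<and> B \<subseteq> U"
      by (intro bexI[of _ "case_prod residue_class (n, residue x n)"] rangeI)
        (simp add: residue_class_def subset_iff)
  qed (auto simp: open_residue_class)
qed simp

lemma sets_borel_padic:
  "sets (borel :: 'p::prime_card padic_int measure) = sigma_sets UNIV (range (case_prod residue_class))"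
  by (subst borel_padic_eq_sigma) simp

lemma Int_stable_residue_class:
  "Int_stable (range (case_prod residue_class) :: 'p::prime_card padic_int set set)"
proof -
  have "residue_class n r \<inter> residue_class m s \<in> (range (case_prod residue_class) :: 'p padic_int set set)"
    if "n \<le> m" for n m r s
  proof (cases "s mod int CARD('p) ^ n = r")
    case True
    then have "residue_class n r \<inter> residue_class m s = (residue_class m s :: 'p padic_int set)"
      using residue_mod[OF that, where 'p='p] by (auto simp: residue_class_def)
    then show ?thesis by (metis case_prod_conv rangeI)
  next
    case False
    then have "residue_class n r \<inter> residue_class m s = ({} :: 'p padic_int set)"
      using residue_mod[OF that, where 'p='p] by (auto simp: residue_class_def)
    also have "\<dots> = residue_class 0 1" by (simp add: residue_class_empty)
    finally show ?thesis by (metis case_prod_conv rangeI)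
  qed
  note * = this
  show ?thesis
    unfolding Int_stable_def
    by (clarsimp, metis * Int_commute nat_le_linear)
qed

lemma measure_padic_eqI:
  fixes \<mu> \<nu> :: "'p::prime_card padic_int measure"
  assumes "sets \<mu> = sets borel" "sets \<nu> = sets borel" "prob_space \<mu>"
    and "\<And>n r. emeasure \<mu> (residue_class n r) = emeasure \<nu> (residue_class n r)"
  shows "\<mu> = \<nu>"
proof (rule measure_eqI_generator_eq[OF Int_stable_residue_class, of UNIV])
  interpret prob_space \<mu> by fact
  have "residue x 0 = 0" for x :: "'p padic_int"
    using residue_nonneg[of x 0] residue_less[of x 0] by simp
  then have 0: "residue_class 0 0 = (UNIV :: 'p padic_int set)"
    by (simp add: residue_class_def)
  show "range (\<lambda>_ :: nat. UNIV) \<subseteq> (range (case_prod residue_class) :: 'p padic_int set set)"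
    by (simp flip: 0) (metis case_prod_conv rangeI)
  show "emeasure \<mu> UNIV \<noteq> \<infinity>" by simp
qed (use assms in \<open>auto simp: sets_borel_padic\<close>)

lemma vimage_add_residue_class:
  fixes a :: "'p::prime_card padic_int"
  assumes "r \<in> {0..<int CARD('p) ^ n}"
  shows "(\<lambda>x. a + x) -` residue_class n r = residue_class n ((r - residue a n) mod int CARD('p) ^ n)"
proof -
  have "residue (a + x) n = r \<longleftrightarrow> residue x n = (r - residue a n) mod int CARD('p) ^ n" for x
  proof
    assume "residue (a + x) n = r"
    then show "residue x n = (r - residue a n) mod int CARD('p) ^ n"
      by (auto simp: plus_padic_int.rep_eq mod_simps)
  next
    assume x: "residue x n = (r - residue a n) mod int CARD('p) ^ n"
    show "residue (a + x) n = r"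
      using assms by (simp add: plus_padic_int.rep_eq x mod_simps)
  qed
  then show ?thesis by (auto simp: residue_class_def)
qed

lemma measurable_padic_add: "(\<lambda>x. a + x) \<in> borel \<rightarrow>\<^sub>M (borel :: 'p::prime_card padic_int measure)"
proof (rule measurable_sigma_sets[OF sets_borel_padic])
  fix A assume "A \<in> (range (case_prod residue_class) :: 'p padic_int set set)"
  then obtain n r where A: "A = residue_class n r" by auto
  show "(\<lambda>x. a + x) -` A \<inter> space borel \<in> sets borel"
    using borel_open[OF open_residue_class] vimage_add_residue_class[of r n a]
      residue_class_empty[of r n, where 'p='p]
    unfolding A by (cases "r \<in> {0..<int CARD('p) ^ n}") auto
qed auto

lemma haar_probI:
  fixes \<mu> :: "'p::prime_card padic_int measure"
  assumes "prob_space \<mu>" and sets [measurable_cong]: "sets \<mu> = sets borel"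
    and eq: "\<And>n r. r \<in> {0..<int CARD('p) ^ n} \<Longrightarrow> emeasure \<mu> (residue_class n r) = c n"
  shows "haar_prob \<mu>"
proof -
  interpret prob_space \<mu> by fact
  have "emeasure \<mu> ((\<lambda>x. a + x) ` A) = emeasure \<mu> A" if A: "A \<in> sets borel" for a A
  proof -
    have m [measurable]: "(\<lambda>x. - a + x) \<in> \<mu> \<rightarrow>\<^sub>M borel"
      using measurable_padic_add[of "- a"] sets measurable_cong_sets by blast
    have spc: "space \<mu> = UNIV" using sets_eq_imp_space_eq[OF sets] by simp
    have "\<mu> = distr \<mu> borel (\<lambda>x. - a + x)"
    proof (rule measure_padic_eqI)
      fix n r
      have d: "emeasure (distr \<mu> borel (\<lambda>x. - a + x)) (residue_class n r)
          = emeasure \<mu> ((\<lambda>x. - a + x) -` residue_class n r)"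
        by (subst emeasure_distr[OF m]) (auto intro: borel_open open_residue_class simp: spc)
      show "emeasure \<mu> (residue_class n r) = emeasure (distr \<mu> borel (\<lambda>x. - a + x)) (residue_class n r)"
      proof (cases "r \<in> {0..<int CARD('p) ^ n}")
        case True
        have "0 < int CARD('p) ^ n" using prime_gt_1_card[where 'p='p] by simp
        then show ?thesis using True unfolding d
          by (subst vimage_add_residue_class) (auto simp: eq)
      next
        case False
        then show ?thesis unfolding d by (simp add: residue_class_empty)
      qed
    qed (use sets prob_space_axioms in auto)
    then have "emeasure \<mu> A = emeasure (distr \<mu> borel (\<lambda>x. - a + x)) A" by metis
    also have "\<dots> = emeasure \<mu> ((\<lambda>x. - a + x) -` A)"
      using A by (subst emeasure_distr[OF m]) (auto simp: spc)
    also have "(\<lambda>x. - a + x) -` A = (\<lambda>x. a + x) ` A"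
      by (force simp: image_iff)
    finally show ?thesis by simp
  qed
  then show ?thesis using assms by (simp add: haar_prob_def)
qed

lemma digit_sum_eq_iff:
  fixes q :: int
  assumes q: "q > 0" and "0 \<le> r" "r < q ^ n"
  shows "(\<Sum>i<n. (w i mod q) * q ^ i) = r \<longleftrightarrow> (\<forall>i<n. w i mod q = r div q ^ i mod q)"
  using assms(2,3)
proof (induction n arbitrary: w r)
  case 0
  then show ?case by simp
next
  case (Suc n)
  let ?S = "\<Sum>i<n. (w (Suc i) mod q) * q ^ i"
  have S: "(\<Sum>i<Suc n. (w i mod q) * q ^ i) = w 0 mod q + q * ?S"
    by (simp add: sum.lessThan_Suc_shift sum_distrib_left mult_ac del: sum.lessThan_Suc)
  have "w 0 mod q + q * ?S = r \<longleftrightarrow> w 0 mod q = r mod q \<and> ?S = r div q"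
  proof
    assume "w 0 mod q + q * ?S = r"
    then show "w 0 mod q = r mod q \<and> ?S = r div q"
      using q by auto
  next
    assume *: "w 0 mod q = r mod q \<and> ?S = r div q"
    show "w 0 mod q + q * ?S = r" unfolding conjunct1[OF *] conjunct2[OF *] by simp
  qed
  moreover have "0 \<le> r div q"
    using q Suc.prems pos_imp_zdiv_nonneg_iff[of q r] by simp
  moreover have "r div q < q ^ n"
  proof (rule ccontr)
    assume "\<not> r div q < q ^ n"
    then have "q * q ^ n \<le> q * (r div q)" using q by simp
    also have "\<dots> \<le> r" using q by (simp add: mult_div_mod_eq minus_mod_eq_mult_div [symmetric])
    finally show False using Suc.prems by simp
  qed
  ultimately show ?case
    unfolding S using q Suc.IH[of "r div q" "\<lambda>i. w (Suc i)"]
    by (simp add: All_less_Suc2 zdiv_zmult2_eq)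
qed

lemma haar_prob_exists: "\<exists>\<mu> :: 'p::prime_card padic_int measure. haar_prob \<mu>"
proof -
  let ?q = "int CARD('p)"
  let ?U = "measure_pmf (pmf_of_set {0..<?q})"
  define D where "D = PiM (UNIV :: nat set) (\<lambda>_. ?U)"
  define S where "S w n = (\<Sum>i<n. (w i mod ?q) * ?q ^ i)" for w n
  have q: "?q > 1" using prime_gt_1_card[where 'p='p] by simp
  have S_bound: "0 \<le> S w n \<and> S w n < ?q ^ n" for w n
  proof (induction n)
    case (Suc n)
    have "w n mod ?q * ?q ^ n \<le> (?q - 1) * ?q ^ n"
      using q by (intro mult_right_mono) (auto simp: zle_diff1_eq)
    moreover have "S w (Suc n) = S w n + w n mod ?q * ?q ^ n"
      by (simp add: S_def)
    moreover have "w n mod ?q * ?q ^ n \<ge> 0" using q by simp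
    ultimately show ?case using Suc by (simp add: algebra_simps)
  qed (simp add: S_def)
  have S_mod: "S w n mod ?q ^ m = S w m" if "m \<le> n" for w n m
    using that
  proof (induction n rule: dec_induct)
    case base
    then show ?case using S_bound by simp
  next
    case (step n)
    have "S w (Suc n) mod ?q ^ m = (S w n + w n mod ?q * ?q ^ n) mod ?q ^ m"
      by (simp add: S_def)
    also have "\<dots> = S w n mod ?q ^ m"
      using le_imp_power_dvd[OF step(1), of ?q] by (metis dvd_mult mod_add_right_eq add_0_right dvd_eq_mod_eq_0)
    finally show ?case using step by simp
  qed
  define X :: "(nat \<Rightarrow> int) \<Rightarrow> 'p padic_int" where "X w = Abs_padic_int (S w)" for w
  have X: "residue (X w) n = S w n" for w n
    using S_mod Abs_padic_int_inverse[of "S w", where 'p='p] by (simp add: X_def)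
  interpret product_prob_space "\<lambda>_. ?U" "UNIV :: nat set"
    by unfold_locales
  have D: "prob_space D" unfolding D_def by (rule P.prob_space_axioms)
  have digit: "emeasure ?U {k. k mod ?q = r mod ?q} = ennreal (1 / real CARD('p))" for r
  proof -
    have "{0..<?q} \<inter> {k. k mod ?q = r mod ?q} = {r mod ?q}"
      using q by auto
    then show ?thesis
      using q by (subst emeasure_pmf_of_set) auto
  qed
  have sets_X: "X -` residue_class n r \<in> sets D \<and>
      emeasure D (X -` residue_class n r) = ennreal (1 / real CARD('p)) ^ n"
    if "r \<in> {0..<?q ^ n}" for n r
  proof -
    have "X -` residue_class n r = {w. \<forall>i<n. w i mod ?q = r div ?q ^ i mod ?q}"
      using that q digit_sum_eq_iff[of ?q r n]
      by (auto simp: residue_class_def X S_def)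
    also have "\<dots> = {w \<in> space D. \<forall>i\<in>{..<n}. w i \<in> {k. k mod ?q = r div ?q ^ i mod ?q}}"
      by (auto simp: D_def space_PiM)
    finally have eq: "X -` residue_class n r = \<dots>" .
    have "\<dots> \<in> sets D"
      unfolding D_def by measurable
    moreover have "emeasure D {w \<in> space D. \<forall>i\<in>{..<n}. w i \<in> {k. k mod ?q = r div ?q ^ i mod ?q}}
        = (\<Prod>i<n. emeasure ?U {k. k mod ?q = r div ?q ^ i mod ?q})"
      unfolding D_def by (subst emeasure_PiM_Collect) auto
    ultimately show ?thesis unfolding eq digit by simp
  qed
  have X_meas [measurable]: "X \<in> D \<rightarrow>\<^sub>M borel"
  proof (rule measurable_sigma_sets[OF sets_borel_padic])
    fix A assume "A \<in> (range (case_prod residue_class) :: 'p padic_int set set)"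
    then obtain n r where A: "A = residue_class n r" by auto
    have "space D = UNIV" by (auto simp: D_def space_PiM)
    then show "X -` A \<inter> space D \<in> sets D"
      using sets_X[of r n] residue_class_empty[of r n, where 'p='p] unfolding A
      by (cases "r \<in> {0..<?q ^ n}") auto
  qed auto
  have "haar_prob (distr D borel X)"
  proof (rule haar_probI)
    show "prob_space (distr D borel X)"
      using D X_meas by (rule prob_space.prob_space_distr)
    fix n r assume r: "r \<in> {0..<?q ^ n}"
    have "space D = UNIV" by (auto simp: D_def space_PiM)
    then show "emeasure (distr D borel X) (residue_class n r) = ennreal (1 / real CARD('p)) ^ n"
      using sets_X[OF r] by (simp add: emeasure_distr borel_open open_residue_class)
  qed simp
  then show ?thesis ..
qed

section \<open>Condition numbers and random polynomials\<close>

definition padic_poly_norm :: "'p::prime_card padic_int poly \<Rightarrow> real"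
  where "padic_poly_norm f = Max ((\<lambda>k. padic_abs (Polynomial.coeff f k)) ` {..degree f})"

text \<open>
  The case distinction gives the value infinity whenever the denominator vanishes, in
  particular for the zero polynomial, where \<^typ>\<open>ennreal\<close> division would yield \<open>0 / 0 = 0\<close>.
\<close>

definition local_condition :: "'p::prime_card padic_int poly \<Rightarrow> 'p padic_int \<Rightarrow> ennreal"
  where "local_condition f x =
    (let m = max (padic_abs (poly f x)) (padic_abs (poly (pderiv f) x))
     in if m = 0 then \<infinity> else ennreal (padic_poly_norm f / m))"

definition global_condition :: "'p::prime_card padic_int poly \<Rightarrow> ennreal"
  where "global_condition f = (SUP z. local_condition f z)"

text \<open>
  \<open>F\<close> is a random polynomial on the probability space \<open>M\<close>. The degree bound is only
  an upper bound, since the leading coefficient may vanish.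
\<close>

definition random_padic_poly :: "'w measure \<Rightarrow> nat \<Rightarrow> ('w \<Rightarrow> 'p::prime_card padic_int poly) \<Rightarrow> bool"
  where "random_padic_poly M d F \<longleftrightarrow>
    prob_space M \<and>
    (\<forall>\<omega>\<in>space M. degree (F \<omega>) \<le> d) \<and>
    prob_space.indep_vars M (\<lambda>_. borel) (\<lambda>k \<omega>. Polynomial.coeff (F \<omega>) k) {..d} \<and>
    (\<forall>k\<le>d. haar_prob (distr M borel (\<lambda>\<omega>. Polynomial.coeff (F \<omega>) k)))"

end

(*
  Put t = ceil(s). Since the norm of f is at most 1, a condition number of at least p^s at x
  forces p^t to divide f(x) and f'(x). If d >= 1, the residues modulo p^t of f_0 and f_1 are then
  determined by those of the other coefficients, so this has probability at most p^(-2t).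
  If d = 0, the condition number of a nonzero f is 1, so f_0 is divisible by every power of p.
  The divisibility of f(x) and f'(x) by p^t depends on x only modulo p^t, and a union bound over
  the p^t residue classes of x gives p^(-t) for the global condition number.
*)

theory Submission
  imports Defs
begin

section \<open>Residues and the absolute value as divisibility by powers of p\<close>

abbreviation padic_p :: "'p::prime_card padic_int"
  where "padic_p \<equiv> of_nat CARD('p)"

lemma card_pos: "0 < CARD('p::prime_card)"
  using prime_gt_1_card[where 'p='p] by linarith

lemma residue_eq_iff_dvd:
  fixes x y :: "'p::prime_card padic_int"
  shows "residue x n = residue y n \<longleftrightarrow> padic_p ^ n dvd x - y"
  by (simp add: power_dvd_iff_residue residue_minus_eq_0_iff)

lemma residue_eq_mono:
  fixes x y :: "'p::prime_card padic_int"
  shows "residue x n = residue y n \<Longrightarrow> m \<le> n \<Longrightarrow> residue x m = residue y m"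
  by (metis residue_mod)

lemma padic_abs_le_iff_dvd:
  fixes x :: "'p::prime_card padic_int"
  shows "padic_abs x \<le> 1 / real CARD('p) ^ n \<longleftrightarrow> padic_p ^ n dvd x"
  by (simp add: padic_abs_le_iff power_dvd_iff_residue)

lemma padic_abs_nonneg: "0 \<le> padic_abs x"
  by (simp add: padic_abs_def)

lemma padic_abs_eq_0_iff: "padic_abs x = 0 \<longleftrightarrow> (x :: 'p::prime_card padic_int) = 0"
  using card_pos[where 'p='p] by (simp add: padic_abs_def)

section \<open>Congruences between polynomial values\<close>

lemma dvd_poly_of_dvd_coeff:
  fixes a :: "'a::comm_ring_1"
  assumes "\<And>k. a dvd Polynomial.coeff f k"
  shows "a dvd poly f x"
  using assms by (simp add: poly_altdef dvd_sum)

lemma dvd_poly_pderiv_of_dvd_coeff: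
  fixes a :: "'a::idom"
  assumes "\<And>k. a dvd Polynomial.coeff f k"
  shows "a dvd poly (pderiv f) x"
  using assms by (intro dvd_poly_of_dvd_coeff) (simp add: coeff_pderiv)

text \<open>By induction along the Horner scheme. It makes divisibility of f(x) and f'(x) by p^n
  depend on x only modulo p^n.\<close>

lemma diff_dvd_poly_diff:
  fixes x y :: "'a::comm_ring_1"
  shows "x - y dvd poly f x - poly f y"
proof (induction f)
  case (pCons a f)
  have "poly (pCons a f) x - poly (pCons a f) y = (x - y) * poly f x + y * (poly f x - poly f y)"
    by (simp add: algebra_simps)
  then show ?case using pCons.IH by (metis dvd_add dvd_mult dvd_triv_left)
qed simp

lemma dvd_iff_of_dvd_diff:
  fixes a :: "'a::comm_ring_1"
  assumes "a dvd x - y"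
  shows "a dvd x \<longleftrightarrow> a dvd y"
  using assms by (metis add.commute diff_add_cancel dvd_add_right_iff)

lemma dvd_poly_cong:
  fixes a :: "'a::comm_ring_1"
  assumes "a dvd x - y"
  shows "a dvd poly f x \<longleftrightarrow> a dvd poly f y"
  using dvd_trans[OF assms diff_dvd_poly_diff] by (rule dvd_iff_of_dvd_diff)

lemma dvd_poly_coeff_cong:
  fixes a x :: "'a::idom"
  assumes "\<And>k. a dvd Polynomial.coeff (f - g) k"
  shows "a dvd poly f x \<longleftrightarrow> a dvd poly g x" "a dvd poly (pderiv f) x \<longleftrightarrow> a dvd poly (pderiv g) x"
proof -
  have "a dvd poly f x - poly g x"
    using dvd_poly_of_dvd_coeff[of a "f - g" x] assms by simp
  then show "a dvd poly f x \<longleftrightarrow> a dvd poly g x"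
    by (rule dvd_iff_of_dvd_diff)
  have "a dvd poly (pderiv f) x - poly (pderiv g) x"
    using dvd_poly_pderiv_of_dvd_coeff[of a "f - g" x] assms by (simp add: pderiv_diff)
  then show "a dvd poly (pderiv f) x \<longleftrightarrow> a dvd poly (pderiv g) x"
    by (rule dvd_iff_of_dvd_diff)
qed

text \<open>
  The value and the derivative at \<open>x\<close> depend on the two lowest coefficients through a
  unitriangular matrix.
\<close>

lemma dvd_coeff_of_dvd_poly_pderiv:
  fixes a x :: "'a::idom"
  assumes high: "\<And>k. 2 \<le> k \<Longrightarrow> a dvd Polynomial.coeff f k"
    and val: "a dvd poly f x" and der: "a dvd poly (pderiv f) x"
  shows "a dvd Polynomial.coeff f k"
proof -
  \<comment> \<open>With f = f0 + f1 T + T^2 h one has f'(x) = f1 + 2 x h(x) + x^2 h'(x). Since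
    \<open>a\<close> divides h(x) and h'(x), back substitution gives f1 from the derivative and then
    f0 from the value.\<close>
  obtain f0 g where f: "f = pCons f0 g" by (cases f)
  obtain f1 h where g: "g = pCons f1 h" by (cases g)
  have h: "a dvd Polynomial.coeff h k" for k
    using high[of "Suc (Suc k)"] by (simp add: f g)
  have "a dvd poly h x" "a dvd poly (pderiv h) x"
    using h by (auto intro: dvd_poly_of_dvd_coeff dvd_poly_pderiv_of_dvd_coeff)
  then have "a dvd x * poly h x + x * (poly h x + x * poly (pderiv h) x)" by simp
  moreover have "poly (pderiv f) x = f1 + (x * poly h x + x * (poly h x + x * poly (pderiv h) x))"
    by (simp add: f g pderiv_pCons algebra_simps)
  ultimately have f1: "a dvd f1" using der by (simp add: dvd_add_left_iff)
  then have "a dvd x * (f1 + x * poly h x)" using \<open>a dvd poly h x\<close> by simp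
  moreover have "poly f x = f0 + x * (f1 + x * poly h x)" by (simp add: f g)
  ultimately have f0: "a dvd f0" using val by (simp add: dvd_add_left_iff)
  consider "k = 0" | "k = 1" | "2 \<le> k" by linarith
  then show ?thesis using f0 f1 high by cases (auto simp: f g)
qed

section \<open>Values of the condition number\<close>

lemma padic_poly_norm_le_iff:
  fixes f :: "'p::prime_card padic_int poly"
  shows "padic_poly_norm f \<le> 1 / real CARD('p) ^ n \<longleftrightarrow> (\<forall>k. padic_p ^ n dvd Polynomial.coeff f k)"
proof -
  have "padic_poly_norm f \<le> 1 / real CARD('p) ^ n
      \<longleftrightarrow> (\<forall>k\<le>degree f. padic_p ^ n dvd Polynomial.coeff f k)"
    by (auto simp: padic_poly_norm_def padic_abs_le_iff_dvd)
  also have "\<dots> \<longleftrightarrow> (\<forall>k. padic_p ^ n dvd Polynomial.coeff f k)"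
    by (metis coeff_eq_0 dvd_0_right not_less)
  finally show ?thesis .
qed

lemma padic_poly_norm_attained:
  obtains k where "padic_poly_norm f = padic_abs (Polynomial.coeff f k)"
proof -
  have "padic_poly_norm f \<in> (\<lambda>k. padic_abs (Polynomial.coeff f k)) ` {..degree f}"
    unfolding padic_poly_norm_def by (rule Max_in) auto
  then show ?thesis using that by blast
qed

lemma one_div_power_le_iff:
  "1 / real CARD('p::prime_card) ^ m \<le> 1 / real CARD('p) ^ n \<longleftrightarrow> n \<le> m"
proof -
  have p: "1 < real CARD('p)" using prime_gt_1_card[where 'p='p] by simp
  then show ?thesis by (simp add: divide_simps power_increasing_iff)
qed

text \<open>The leading coefficient is nonzero, so the maximum is positive. It is therefore attained
  at a nonzero coefficient, whose absolute value is p^(-v) for its valuation v.\<close>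

lemma padic_poly_norm_eq:
  fixes f :: "'p::prime_card padic_int poly"
  assumes "f \<noteq> 0"
  obtains v where "padic_poly_norm f = 1 / real CARD('p) ^ v"
proof -
  obtain k where k: "padic_poly_norm f = padic_abs (Polynomial.coeff f k)"
    by (rule padic_poly_norm_attained)
  have "padic_abs (Polynomial.coeff f (degree f)) \<le> padic_poly_norm f"
    unfolding padic_poly_norm_def by (rule Max_ge) auto
  moreover have "0 < padic_abs (Polynomial.coeff f (degree f))"
    using assms by (metis leading_coeff_0_iff padic_abs_eq_0_iff padic_abs_nonneg order_le_less)
  ultimately have "Polynomial.coeff f k \<noteq> 0"
    using k by (auto simp: padic_abs_def)
  then show ?thesis using that k by (simp add: padic_abs_def)
qed

lemma local_condition_0: "local_condition 0 x = \<infinity>"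
  by (simp add: local_condition_def padic_abs_def)

text \<open>A nonzero denominator equals p^(-w) for some w. Since p^v divides all coefficients, it
  divides f(x) and f'(x), so v <= w and the quotient is p^j with j = w - v. Thus condition numbers
  take only the values 1, p, p^2, ... and infinity.\<close>

lemma local_condition_cases:
  fixes f :: "'p::prime_card padic_int poly"
  assumes "padic_poly_norm f = 1 / real CARD('p) ^ v"
  obtains "local_condition f x = \<infinity>" "poly f x = 0" "poly (pderiv f) x = 0"
  | j where "local_condition f x = ennreal (real CARD('p) ^ j)"
    "\<And>n. padic_p ^ n dvd poly f x \<and> padic_p ^ n dvd poly (pderiv f) x \<longleftrightarrow> n \<le> v + j"
proof -
  define m where "m = max (padic_abs (poly f x)) (padic_abs (poly (pderiv f) x))"
  have m_le: "m \<le> 1 / real CARD('p) ^ n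
      \<longleftrightarrow> padic_p ^ n dvd poly f x \<and> padic_p ^ n dvd poly (pderiv f) x" for n
    by (simp add: m_def padic_abs_le_iff_dvd)
  show ?thesis
  proof (cases "m = 0")
    case True
    then have "local_condition f x = \<infinity>" by (simp add: local_condition_def m_def)
    moreover have "padic_abs (poly f x) = 0" "padic_abs (poly (pderiv f) x) = 0"
      using True padic_abs_nonneg[of "poly f x"] padic_abs_nonneg[of "poly (pderiv f) x"]
      unfolding m_def by linarith+
    ultimately show ?thesis using that(1) by (simp add: padic_abs_eq_0_iff)
  next
    case False
    have "\<exists>w. m = 1 / real CARD('p) ^ w"
      using False unfolding m_def max_def by (auto simp: padic_abs_def split: if_splits)
    then obtain w where w: "m = 1 / real CARD('p) ^ w" ..
    have "padic_p ^ v dvd Polynomial.coeff f k" for k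
      using assms padic_poly_norm_le_iff[of f v] by simp
    then have "m \<le> 1 / real CARD('p) ^ v"
      unfolding m_le by (blast intro: dvd_poly_of_dvd_coeff dvd_poly_pderiv_of_dvd_coeff)
    then have "v \<le> w" unfolding w one_div_power_le_iff .
    then obtain j where j: "w = v + j" using le_Suc_ex by blast
    have "padic_poly_norm f / m = real CARD('p) ^ j"
      using card_pos[where 'p='p] by (simp add: assms w j power_add)
    then have "local_condition f x = ennreal (real CARD('p) ^ j)"
      using False by (simp add: local_condition_def m_def)
    moreover have "padic_p ^ n dvd poly f x \<and> padic_p ^ n dvd poly (pderiv f) x \<longleftrightarrow> n \<le> v + j" for n
      using m_le[of n] unfolding w j one_div_power_le_iff by simp
    ultimately show ?thesis using that(2) by blast
  qed
qed

text \<open>Finite condition numbers are powers p^j, so a real threshold s can be rounded up to a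
  natural number. For negative s, \<open>nat\<close> truncates to 0 and both sides hold.\<close>

lemma powr_le_power_iff:
  fixes s :: real
  shows "real CARD('p::prime_card) powr s \<le> real CARD('p) ^ j \<longleftrightarrow> nat \<lceil>s\<rceil> \<le> j"
proof -
  have "1 < real CARD('p)" using prime_gt_1_card[where 'p='p] by simp
  then have "real CARD('p) powr s \<le> real CARD('p) ^ j \<longleftrightarrow> s \<le> real j"
    by (simp flip: powr_realpow)
  then show ?thesis by linarith
qed

lemma powr_minus_nat_ceiling_le:
  fixes s :: real
  shows "1 / real CARD('p::prime_card) ^ nat \<lceil>s\<rceil> \<le> real CARD('p) powr - s"
proof -
  have "real CARD('p) powr s \<le> real CARD('p) ^ nat \<lceil>s\<rceil>" by (simp add: powr_le_power_iff)
  then show ?thesis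
    using card_pos[where 'p='p] by (simp add: powr_minus divide_simps)
qed

text \<open>
  Quantifying over all \<open>n\<close> avoids the norm of \<open>f\<close>: the instance that matters is the largest
  \<open>n\<close> for which the premise holds. This form also covers the zero polynomial.
\<close>

lemma local_condition_ge_iff:
  fixes f :: "'p::prime_card padic_int poly"
  shows "ennreal (real CARD('p) powr s) \<le> local_condition f x \<longleftrightarrow>
    (\<forall>n. (\<forall>k. padic_p ^ n dvd Polynomial.coeff f k) \<longrightarrow>
      padic_p ^ (n + nat \<lceil>s\<rceil>) dvd poly f x \<and> padic_p ^ (n + nat \<lceil>s\<rceil>) dvd poly (pderiv f) x)"
proof (cases "f = 0")
  case True
  then show ?thesis by (simp add: local_condition_0)
next
  case False
  then obtain v where v: "padic_poly_norm f = 1 / real CARD('p) ^ v"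
    by (rule padic_poly_norm_eq)
  have n: "(\<forall>k. padic_p ^ n dvd Polynomial.coeff f k) \<longleftrightarrow> n \<le> v" for n
    using padic_poly_norm_le_iff[of f n] unfolding v one_div_power_le_iff by simp
  from v show ?thesis
  proof (cases rule: local_condition_cases[of f v x])
    case 1
    then show ?thesis by simp
  next
    case (2 j)
    have "ennreal (real CARD('p) powr s) \<le> local_condition f x
        \<longleftrightarrow> real CARD('p) powr s \<le> real CARD('p) ^ j"
      unfolding 2(1) by (simp add: ennreal_le_iff)
    also have "\<dots> \<longleftrightarrow> nat \<lceil>s\<rceil> \<le> j" by (rule powr_le_power_iff)
    also have "\<dots> \<longleftrightarrow> (\<forall>n\<le>v. n + nat \<lceil>s\<rceil> \<le> v + j)"
      by (meson add_le_cancel_left add_le_mono order_refl)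
    finally show ?thesis unfolding n 2(2) .
  qed
qed

text \<open>The instance n = 0, whose premise is trivial, expresses that the norm of f is at most
  1.\<close>

lemma local_condition_ge_imp_dvd:
  fixes f :: "'p::prime_card padic_int poly"
  assumes "ennreal (real CARD('p) powr s) \<le> local_condition f x"
  shows "padic_p ^ nat \<lceil>s\<rceil> dvd poly f x" "padic_p ^ nat \<lceil>s\<rceil> dvd poly (pderiv f) x"
  using assms[unfolded local_condition_ge_iff, rule_format, of 0] by simp_all

text \<open>A bootstrap with t the rounded exponent: n = 0 gives that p^t divides the constant c,
  which is the premise for n = t, and that instance gives p^(2t).\<close>

lemma local_condition_ge_imp_dvd_const:
  fixes f :: "'p::prime_card padic_int poly"
  assumes "ennreal (real CARD('p) powr s) \<le> local_condition f x" and "degree f = 0"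
  shows "padic_p ^ (2 * nat \<lceil>s\<rceil>) dvd Polynomial.coeff f 0"
proof -
  obtain c where f: "f = [:c:]" using assms(2) by (rule degree_eq_zeroE)
  have c: "padic_p ^ nat \<lceil>s\<rceil> dvd c"
    using local_condition_ge_imp_dvd(1)[OF assms(1)] by (simp add: f)
  have "\<forall>k. padic_p ^ nat \<lceil>s\<rceil> dvd Polynomial.coeff f k"
    using c by (auto simp: f coeff_pCons split: nat.split)
  then show ?thesis
    using assms(1)[unfolded local_condition_ge_iff, rule_format, of "nat \<lceil>s\<rceil>"]
    by (simp add: f mult_2)
qed

text \<open>The supremum is attained because the values form a discrete set.\<close>

lemma global_condition_ge_iff:
  fixes f :: "'p::prime_card padic_int poly"
  assumes s: "0 \<le> s"
  shows "ennreal (real CARD('p) powr s) \<le> global_condition f \<longleftrightarrow>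
    (\<exists>z. ennreal (real CARD('p) powr s) \<le> local_condition f z)"
proof
  assume ge: "ennreal (real CARD('p) powr s) \<le> global_condition f"
  show "\<exists>z. ennreal (real CARD('p) powr s) \<le> local_condition f z"
  proof (cases "f = 0 \<or> s = 0")
    case True
    then show ?thesis
    proof
      \<comment> \<open>Any point works here: a power of p that divides all coefficients also
        divides the value and the derivative.\<close>
      assume "s = 0"
      then show ?thesis
        unfolding local_condition_ge_iff
        by (auto intro: dvd_poly_of_dvd_coeff dvd_poly_pderiv_of_dvd_coeff)
    qed (simp add: local_condition_0)
  next
    case False
    then obtain v where v: "padic_poly_norm f = 1 / real CARD('p) ^ v"
      using padic_poly_norm_eq by blast
    \<comment> \<open>Let t = i + 1 be s rounded up. Then p^i < p^s strictly, so some local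
      condition number exceeds p^i. Being a power of p or infinite, it is at least p^(i+1), hence at
      least p^s.\<close>
    have "0 < nat \<lceil>s\<rceil>" using False s by simp
    then obtain i where i: "nat \<lceil>s\<rceil> = Suc i" using gr0_implies_Suc by blast
    have "\<not> real CARD('p) powr s \<le> real CARD('p) ^ i"
      unfolding powr_le_power_iff i by simp
    then have "ennreal (real CARD('p) ^ i) < ennreal (real CARD('p) powr s)"
      by (simp add: ennreal_less_iff)
    also note ge
    finally obtain z where z: "ennreal (real CARD('p) ^ i) < local_condition f z"
      unfolding global_condition_def less_SUP_iff by blast
    from v have "ennreal (real CARD('p) powr s) \<le> local_condition f z"
    proof (cases rule: local_condition_cases[of f v z])
      case (2 j)
      have "real CARD('p) ^ i < real CARD('p) ^ j"
        using z unfolding 2(1) by (simp add: ennreal_less_iff)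
      then have "i < j"
        using prime_gt_1_card[where 'p='p] by (simp add: power_strict_increasing_iff)
      then show ?thesis
        unfolding 2(1) by (intro ennreal_leI) (simp only: powr_le_power_iff i Suc_le_eq)
    qed simp
    then show ?thesis ..
  qed
next
  assume "\<exists>z. ennreal (real CARD('p) powr s) \<le> local_condition f z"
  then show "ennreal (real CARD('p) powr s) \<le> global_condition f"
    unfolding global_condition_def by (meson SUP_upper UNIV_I order_trans)
qed

text \<open>Natural numbers represent all residue classes. This supplies both the countable set of
  points for measurability and the p^t representatives for the union bound.\<close>

lemma residue_of_nat_residue:
  fixes x :: "'p::prime_card padic_int"
  shows "residue (of_nat (nat (residue x n)) :: 'p padic_int) n = residue x n"
  unfolding residue_of_nat by (simp add: residue_nonneg)

text \<open>For measurability, the supremum has to be reduced to countably many points.\<close>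

lemma local_condition_ge_of_nat:
  fixes f :: "'p::prime_card padic_int poly"
  assumes "ennreal (real CARD('p) powr s) \<le> local_condition f x"
  obtains z :: nat where "ennreal (real CARD('p) powr s) \<le> local_condition f (of_nat z)"
proof (cases "f = 0")
  case True
  then show ?thesis using that[of 0] by (simp add: local_condition_0)
next
  case False
  then obtain v where v: "padic_poly_norm f = 1 / real CARD('p) ^ v"
    by (rule padic_poly_norm_eq)
  let ?t = "nat \<lceil>s\<rceil>"
  \<comment> \<open>The divisibility conditions concern p^(n+t) for n <= v only, so agreement with x
    modulo p^(v+t) suffices. As v depends on f, no finite set of points is obtained here.\<close>
  define z where "z = nat (residue x (v + ?t))"
  have "ennreal (real CARD('p) powr s) \<le> local_condition f (of_nat z)"
    unfolding local_condition_ge_iff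
  proof (intro allI impI)
    fix n assume n: "\<forall>k. padic_p ^ n dvd Polynomial.coeff f k"
    then have "n + ?t \<le> v + ?t"
      using padic_poly_norm_le_iff[of f n] unfolding v one_div_power_le_iff by simp
    moreover have "residue x (v + ?t) = residue (of_nat z :: 'p padic_int) (v + ?t)"
      unfolding z_def by (rule residue_of_nat_residue[symmetric])
    ultimately have "residue x (n + ?t) = residue (of_nat z :: 'p padic_int) (n + ?t)"
      by (rule residue_eq_mono[rotated])
    then have d: "padic_p ^ (n + ?t) dvd x - of_nat z" by (simp add: residue_eq_iff_dvd)
    have "padic_p ^ (n + ?t) dvd poly f x \<and> padic_p ^ (n + ?t) dvd poly (pderiv f) x"
      using assms n unfolding local_condition_ge_iff by blast
    then show "padic_p ^ (n + ?t) dvd poly f (of_nat z) \<and> padic_p ^ (n + ?t) dvd poly (pderiv f) (of_nat z)"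
      by (simp only: dvd_poly_cong[OF d])
  qed
  then show ?thesis by (rule that)
qed

section \<open>Haar measure of residue classes\<close>

text \<open>The p^n residue classes partition the space and are translates of the class of 0, so
  invariance gives them equal measure.\<close>

lemma measure_residue_class:
  fixes \<mu> :: "'p::prime_card padic_int measure"
  assumes "haar_prob \<mu>" and r: "r \<in> {0..<int CARD('p) ^ n}"
  shows "measure \<mu> (residue_class n r) = 1 / real CARD('p) ^ n"
proof -
  let ?q = "int CARD('p) ^ n"
  interpret prob_space \<mu> using assms by (simp add: haar_prob_def)
  have sets: "sets \<mu> = sets borel" using assms by (simp add: haar_prob_def)
  have S: "residue_class n i \<in> sets \<mu>" for i
    unfolding sets by (intro borel_open open_residue_class)
  have eq: "measure \<mu> (residue_class n i) = measure \<mu> (residue_class n 0)" if i: "i \<in> {0..<?q}" for i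
  proof -
    have "residue (of_nat (nat i) :: 'p padic_int) n = i"
      using i unfolding residue_of_nat by simp
    then obtain a :: "'p padic_int" where a: "residue a n = i" ..
    have "(\<lambda>x. a + x) ` residue_class n 0 = residue_class n i"
    proof (intro equalityI subsetI)
      fix x :: "'p padic_int" assume "x \<in> residue_class n i"
      then have "x - a \<in> residue_class n 0"
        by (simp add: residue_class_def residue_minus_eq_0_iff a)
      then show "x \<in> (\<lambda>x. a + x) ` residue_class n 0"
        by (rule rev_image_eqI) simp
    next
      fix x assume "x \<in> (\<lambda>x. a + x) ` residue_class n 0"
      then have "residue (x - a) n = 0" by (auto simp: residue_class_def)
      then have "residue x n = residue a n" by (simp only: residue_minus_eq_0_iff)
      then show "x \<in> residue_class n i" by (simp only: residue_class_def a mem_Collect_eq)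
    qed
    moreover have "emeasure \<mu> ((\<lambda>x. a + x) ` residue_class n 0) = emeasure \<mu> (residue_class n 0)"
      using assms(1) S unfolding haar_prob_def sets by blast
    ultimately show ?thesis by (simp add: measure_def)
  qed
  have "(\<Union>i\<in>{0..<?q}. residue_class n i) = space \<mu>"
    using sets_eq_imp_space_eq[OF sets] residue_nonneg residue_less
    by (auto simp: residue_class_def)
  then have "1 = measure \<mu> (\<Union>i\<in>{0..<?q}. residue_class n i)"
    by (simp add: prob_space)
  also have "\<dots> = (\<Sum>i\<in>{0..<?q}. measure \<mu> (residue_class n i))"
    using S by (intro finite_measure_finite_Union)
      (auto simp: disjoint_family_on_def residue_class_def)
  also have "\<dots> = (\<Sum>i\<in>{0..<?q}. measure \<mu> (residue_class n r))"
    by (intro sum.cong refl) (metis eq r)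
  also have "\<dots> = real CARD('p) ^ n * measure \<mu> (residue_class n r)"
    by simp
  finally show ?thesis
    using card_pos[where 'p='p] by (simp add: field_simps)
qed

section \<open>Random polynomials\<close>

lemma random_padic_poly_measurable:
  fixes F :: "'w \<Rightarrow> 'p::prime_card padic_int poly"
  assumes "random_padic_poly M d F" "k \<le> d"
  shows "(\<lambda>\<omega>. Polynomial.coeff (F \<omega>) k) \<in> M \<rightarrow>\<^sub>M borel"
proof -
  interpret prob_space M using assms by (simp add: random_padic_poly_def)
  show ?thesis using assms by (auto simp: random_padic_poly_def indep_vars_def)
qed

lemma prob_residue_coeff:
  fixes F :: "'w \<Rightarrow> 'p::prime_card padic_int poly"
  assumes R: "random_padic_poly M d F" and k: "k \<le> d" and r: "r \<in> {0..<int CARD('p) ^ n}"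
  shows "measure M ((\<lambda>\<omega>. Polynomial.coeff (F \<omega>) k) -` residue_class n r \<inter> space M)
    = 1 / real CARD('p) ^ n"
proof -
  have "haar_prob (distr M borel (\<lambda>\<omega>. Polynomial.coeff (F \<omega>) k))"
    using R k by (simp add: random_padic_poly_def)
  from measure_residue_class[OF this r] show ?thesis
    using random_padic_poly_measurable[OF R k]
    by (simp add: measure_distr borel_open open_residue_class)
qed

text \<open>By independence the probability is a product over the d + 1 coefficients, each factor
  being p^(-n).\<close>

lemma prob_residues_coeff:
  fixes F :: "'w \<Rightarrow> 'p::prime_card padic_int poly"
  assumes R: "random_padic_poly M d F" and c: "c \<in> (\<Pi>\<^sub>E k\<in>{..d}. {0..<int CARD('p) ^ n})"
  shows "(\<Inter>k\<in>{..d}. (\<lambda>\<omega>. Polynomial.coeff (F \<omega>) k) -` residue_class n (c k) \<inter> space M) \<in> sets M"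
      (is "?A \<in> _")
    and "measure M (\<Inter>k\<in>{..d}. (\<lambda>\<omega>. Polynomial.coeff (F \<omega>) k) -` residue_class n (c k) \<inter> space M)
      = (1 / real CARD('p) ^ n) ^ Suc d"
proof -
  interpret prob_space M using R by (simp add: random_padic_poly_def)
  show "?A \<in> sets M"
    using random_padic_poly_measurable[OF R]
    by (intro sets.finite_INT measurable_sets) (auto intro: borel_open open_residue_class)
  have "measure M ?A = (\<Prod>k\<in>{..d}. measure M ((\<lambda>\<omega>. Polynomial.coeff (F \<omega>) k) -` residue_class n (c k) \<inter> space M))"
    using R unfolding random_padic_poly_def
    by (intro indep_varsD[where M'="\<lambda>_. borel" and I="{..d}"]) (auto intro: borel_open open_residue_class)
  also have "\<dots> = (\<Prod>k\<in>{..d}. 1 / real CARD('p) ^ n)"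
    using c by (intro prod.cong prob_residue_coeff[OF R]) auto
  finally show "measure M ?A = (1 / real CARD('p) ^ n) ^ Suc d" by simp
qed

text \<open>
  An event that depends only on the coefficients modulo \<open>p\<^sup>n\<close> is a finite union of cylinders,
  one for each vector of residues that it realizes.
\<close>

lemma residue_event:
  fixes F :: "'w \<Rightarrow> 'p::prime_card padic_int poly"
  assumes R: "random_padic_poly M d F"
    and Q: "\<And>f g. \<lbrakk>\<And>k. padic_p ^ n dvd Polynomial.coeff (f - g) k; Q f\<rbrakk> \<Longrightarrow> Q g"
  defines "E \<equiv> {\<omega> \<in> space M. Q (F \<omega>)}"
  shows "E \<in> sets M"
    and "measure M E \<le> real (card ((\<lambda>\<omega>. \<lambda>k\<in>{..d}. residue (Polynomial.coeff (F \<omega>) k) n) ` E))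
      * (1 / real CARD('p) ^ n) ^ Suc d"
proof -
  interpret prob_space M using R by (simp add: random_padic_poly_def)
  define res where "res \<omega> = (\<lambda>k\<in>{..d}. residue (Polynomial.coeff (F \<omega>) k) n)" for \<omega>
  define cyl where "cyl c = (\<Inter>k\<in>{..d}. (\<lambda>\<omega>. Polynomial.coeff (F \<omega>) k) -` residue_class n (c k) \<inter> space M)" for c
  have res: "res \<omega> \<in> (\<Pi>\<^sub>E k\<in>{..d}. {0..<int CARD('p) ^ n})" for \<omega>
    by (auto simp: res_def residue_nonneg residue_less)
  then have fin: "finite (res ` E)"
    by (intro finite_subset[OF _ finite_PiE[of "{..d}" "\<lambda>_. {0..<int CARD('p) ^ n}"]]) auto
  have cyl: "cyl c \<in> sets M" "measure M (cyl c) = (1 / real CARD('p) ^ n) ^ Suc d"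
    if "c \<in> res ` E" for c
    using that res prob_residues_coeff[OF R, of c n] unfolding cyl_def by auto
  have E: "E = (\<Union>c\<in>res ` E. cyl c)"
  proof (intro equalityI subsetI)
    fix \<omega> assume "\<omega> \<in> E"
    moreover from this have "\<omega> \<in> cyl (res \<omega>)"
      by (auto simp: E_def cyl_def res_def residue_class_def)
    ultimately show "\<omega> \<in> (\<Union>c\<in>res ` E. cyl c)" by blast
  next
    fix \<omega> assume "\<omega> \<in> (\<Union>c\<in>res ` E. cyl c)"
    then obtain \<omega>' where w': "\<omega>' \<in> E" "\<omega> \<in> cyl (res \<omega>')" by blast
    then have sp: "\<omega> \<in> space M" "\<omega>' \<in> space M" "Q (F \<omega>')" by (auto simp: cyl_def E_def)
    have "padic_p ^ n dvd Polynomial.coeff (F \<omega>' - F \<omega>) k" for k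
    proof (cases "k \<le> d")
      case True
      then have "residue (Polynomial.coeff (F \<omega>') k) n = residue (Polynomial.coeff (F \<omega>) k) n"
        using w'(2) by (auto simp: cyl_def res_def residue_class_def)
      then show ?thesis by (simp add: residue_eq_iff_dvd)
    next
      case False
      then have "degree (F \<omega>') < k" "degree (F \<omega>) < k"
        using R sp by (force simp: random_padic_poly_def)+
      then show ?thesis by (simp add: coeff_eq_0)
    qed
    then have "Q (F \<omega>)" using Q sp(3) by blast
    then show "\<omega> \<in> E" using sp by (simp add: E_def)
  qed
  show "E \<in> sets M" using fin cyl(1) by (subst E) (rule sets.finite_UN)
  have "measure M E \<le> (\<Sum>c\<in>res ` E. measure M (cyl c))"
    using fin cyl(1) by (subst E) (intro measure_UNION_le)
  also have "\<dots> = real (card (res ` E)) * (1 / real CARD('p) ^ n) ^ Suc d"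
    using cyl(2) by simp
  finally show "measure M E \<le> real (card ((\<lambda>\<omega>. \<lambda>k\<in>{..d}. residue (Polynomial.coeff (F \<omega>) k) n) ` E))
      * (1 / real CARD('p) ^ n) ^ Suc d"
    unfolding res_def .
qed

section \<open>Measurability of the events of large condition number\<close>

text \<open>The norm of f can be arbitrarily small, so in general no single modulus decides the
  event. It is a countable intersection over n, and its n-th member depends on the coefficients
  modulo p^(n+t).\<close>

lemma sets_local_condition_ge:
  fixes F :: "'w \<Rightarrow> 'p::prime_card padic_int poly"
  assumes R: "random_padic_poly M d F"
  shows "{\<omega> \<in> space M. ennreal (real CARD('p) powr s) \<le> local_condition (F \<omega>) x} \<in> sets M"
proof -
  let ?t = "nat \<lceil>s\<rceil>"
  let ?Q = "\<lambda>n f. (\<forall>k. padic_p ^ n dvd Polynomial.coeff f k) \<longrightarrow>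
      padic_p ^ (n + ?t) dvd poly f x \<and> padic_p ^ (n + ?t) dvd poly (pderiv f) x"
  have "{\<omega> \<in> space M. ?Q n (F \<omega>)} \<in> sets M" for n
  proof (rule residue_event(1)[OF R])
    fix f g :: "'p padic_int poly"
    assume fg: "\<And>k. padic_p ^ (n + ?t) dvd Polynomial.coeff (f - g) k" and f: "?Q n f"
    \<comment> \<open>\<open>?Q\<close> is an implication, so its premise has to be carried back
      from g to f.\<close>
    have "padic_p ^ n dvd Polynomial.coeff f k" if "padic_p ^ n dvd Polynomial.coeff g k" for k
    proof -
      have "padic_p ^ n dvd Polynomial.coeff f k - Polynomial.coeff g k"
        using power_le_dvd[OF fg[of k] le_add1] by simp
      then show ?thesis using that by (simp only: dvd_iff_of_dvd_diff)
    qed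
    then show "?Q n g" using f unfolding dvd_poly_coeff_cong[OF fg] by blast
  qed
  then have "(\<Inter>n. {\<omega> \<in> space M. ?Q n (F \<omega>)}) \<in> sets M" by blast
  also have "(\<Inter>n. {\<omega> \<in> space M. ?Q n (F \<omega>)})
      = {\<omega> \<in> space M. ennreal (real CARD('p) powr s) \<le> local_condition (F \<omega>) x}"
    unfolding local_condition_ge_iff by blast
  finally show ?thesis .
qed

lemma sets_global_condition_ge:
  fixes F :: "'w \<Rightarrow> 'p::prime_card padic_int poly"
  assumes R: "random_padic_poly M d F" and s: "0 \<le> s"
  shows "{\<omega> \<in> space M. ennreal (real CARD('p) powr s) \<le> global_condition (F \<omega>)} \<in> sets M"
proof -
  have "{\<omega> \<in> space M. ennreal (real CARD('p) powr s) \<le> global_condition (F \<omega>)}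
      = (\<Union>z::nat. {\<omega> \<in> space M. ennreal (real CARD('p) powr s) \<le> local_condition (F \<omega>) (of_nat z)})"
    unfolding global_condition_ge_iff[OF s] by (blast elim: local_condition_ge_of_nat)
  also have "\<dots> \<in> sets M"
    by (intro sets.countable_UN image_subsetI sets_local_condition_ge[OF R])
  finally show ?thesis .
qed

text \<open>
  A necessary condition for a condition number of at least \<open>p\<^sup>t\<close> at \<open>x\<close>. The last conjunct is there
  because for \<open>d = 0\<close> the first two only have probability \<open>p\<^sup>-\<^sup>t\<close> instead of \<open>p\<^sup>-\<^sup>2\<^sup>t\<close>.
\<close>

definition near_singular :: "nat \<Rightarrow> nat \<Rightarrow> 'p::prime_card padic_int \<Rightarrow> 'p padic_int poly \<Rightarrow> bool"
  where "near_singular d t x f \<longleftrightarrow>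
    padic_p ^ t dvd poly f x \<and> padic_p ^ t dvd poly (pderiv f) x \<and>
    (d = 0 \<longrightarrow> padic_p ^ (2 * t) dvd Polynomial.coeff f 0)"

lemma near_singular_of_local_condition_ge:
  fixes f :: "'p::prime_card padic_int poly"
  assumes "ennreal (real CARD('p) powr s) \<le> local_condition f x" and "degree f \<le> d"
  shows "near_singular d (nat \<lceil>s\<rceil>) x f"
  using local_condition_ge_imp_dvd[OF assms(1)] local_condition_ge_imp_dvd_const[OF assms(1)] assms(2)
  by (simp add: near_singular_def)

text \<open>Reduces a union over all points x to one over p^t representatives.\<close>

lemma near_singular_cong:
  fixes x y :: "'p::prime_card padic_int"
  assumes "residue x t = residue y t"
  shows "near_singular d t x f \<longleftrightarrow> near_singular d t y f"
  using assms dvd_poly_cong unfolding near_singular_def residue_eq_iff_dvd by blast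

text \<open>For d >= 1 at most p^(t(d-1)) of the p^(t(d+1)) coefficient vectors modulo p^t are
  admissible. For d = 0 the event lies in the residue class of 0 modulo p^(2t) for the only
  coefficient.\<close>

lemma prob_near_singular:
  fixes F :: "'w \<Rightarrow> 'p::prime_card padic_int poly"
  assumes R: "random_padic_poly M d F"
  defines "E \<equiv> \<lambda>t x. {\<omega> \<in> space M. near_singular d t x (F \<omega>)}"
  shows "E t x \<in> sets M" and "measure M (E t x) \<le> 1 / real CARD('p) ^ (2 * t)"
proof -
  interpret prob_space M using R by (simp add: random_padic_poly_def)
  have deg: "degree (F \<omega>) \<le> d" if "\<omega> \<in> space M" for \<omega>
    using R that by (simp add: random_padic_poly_def)
  show "E t x \<in> sets M"
    unfolding E_def
  \<comment> \<open>The modulus is p^(2t) rather than p^t because of the last conjunct of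
    \<open>near_singular\<close>.\<close>
  proof (rule residue_event(1)[OF R])
    fix f g :: "'p padic_int poly"
    assume fg: "\<And>k. padic_p ^ (2 * t) dvd Polynomial.coeff (f - g) k" and f: "near_singular d t x f"
    have t: "padic_p ^ t dvd Polynomial.coeff (f - g) k" for k
      using power_le_dvd[OF fg[of k], of t] by simp
    have "padic_p ^ (2 * t) dvd Polynomial.coeff f 0 \<longleftrightarrow> padic_p ^ (2 * t) dvd Polynomial.coeff g 0"
      using fg[of 0] by (intro dvd_iff_of_dvd_diff) simp
    then show "near_singular d t x g"
      using f unfolding near_singular_def dvd_poly_coeff_cong[OF t] by blast
  qed
  show "measure M (E t x) \<le> 1 / real CARD('p) ^ (2 * t)"
  proof (cases "d = 0")
    case True
    let ?A = "(\<lambda>\<omega>. Polynomial.coeff (F \<omega>) 0) -` residue_class (2 * t) 0 \<inter> space M"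
    have "E t x \<subseteq> ?A"
      using True by (auto simp: E_def near_singular_def residue_class_def power_dvd_iff_residue)
    moreover have "?A \<in> sets M"
      using random_padic_poly_measurable[OF R, of 0]
      by (intro measurable_sets) (auto intro: borel_open open_residue_class)
    ultimately have "measure M (E t x) \<le> measure M ?A" by (rule finite_measure_mono)
    also have "\<dots> = 1 / real CARD('p) ^ (2 * t)"
      using card_pos[where 'p='p] by (intro prob_residue_coeff[OF R]) auto
    finally show ?thesis .
  next
    case False
    then obtain e where e: "d = Suc e" using not0_implies_Suc by blast
    let ?q = "int CARD('p) ^ t"
    let ?Q = "\<lambda>f. padic_p ^ t dvd poly f x \<and> padic_p ^ t dvd poly (pderiv f) x"
    let ?res = "\<lambda>\<omega>. \<lambda>k\<in>{..d}. residue (Polynomial.coeff (F \<omega>) k) t"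
    have Eeq: "E t x = {\<omega> \<in> space M. ?Q (F \<omega>)}"
      using False by (auto simp: E_def near_singular_def)
    let ?C = "?res ` E t x"
    \<comment> \<open>If two realized residue vectors agree from index 2 on, the difference of the
      polynomials has high coefficients, value and derivative at x all divisible by p^t. By
      \<open>dvd_coeff_of_dvd_poly_pderiv\<close> the two lowest residues then agree as
      well.\<close>
    have inj: "inj_on (\<lambda>c. restrict c {2..d}) ?C"
    proof (rule inj_onI)
      fix b c assume "b \<in> ?C" "c \<in> ?C" and bc: "restrict b {2..d} = restrict c {2..d}"
      then obtain \<omega> \<omega>' where w: "\<omega> \<in> E t x" "\<omega>' \<in> E t x" and b: "b = ?res \<omega>" and c: "c = ?res \<omega>'"
        by blast
      have val: "padic_p ^ t dvd poly (F \<omega> - F \<omega>') x" "padic_p ^ t dvd poly (pderiv (F \<omega> - F \<omega>')) x"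
        using w unfolding Eeq by (simp_all add: pderiv_diff dvd_diff)
      have high: "padic_p ^ t dvd Polynomial.coeff (F \<omega> - F \<omega>') k" if "2 \<le> k" for k
      proof (cases "k \<le> d")
        case True
        then have "b k = c k" using bc that by (metis atLeastAtMost_iff restrict_apply')
        then show ?thesis using True by (simp add: b c residue_eq_iff_dvd)
      next
        case False
        then have "degree (F \<omega>) < k" "degree (F \<omega>') < k"
          using deg w by (force simp: E_def)+
        then show ?thesis by (simp add: coeff_eq_0)
      qed
      have "padic_p ^ t dvd Polynomial.coeff (F \<omega> - F \<omega>') k" for k
        using high val by (rule dvd_coeff_of_dvd_poly_pderiv)
      then show "b = c" by (simp add: b c fun_eq_iff residue_eq_iff_dvd)
    qed
    \<comment> \<open>The indices from 2 to d number e = d - 1. Multiplying (p^t)^e by the cylinder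
      probability (p^(-t))^(e+2) leaves p^(-2t).\<close>
    have "card ?C \<le> card (\<Pi>\<^sub>E k\<in>{2..d}. {0..<?q})"
      using inj by (rule card_inj_on_le)
        (auto simp: residue_nonneg residue_less intro: finite_PiE)
    also have "\<dots> = (CARD('p) ^ t) ^ e"
      by (simp add: card_PiE e nat_power_eq)
    finally have card: "real (card ?C) \<le> (real CARD('p) ^ t) ^ e"
      by (metis of_nat_le_iff of_nat_power)
    have "measure M (E t x) \<le> real (card ?C) * (1 / real CARD('p) ^ t) ^ Suc d"
      unfolding Eeq by (rule residue_event(2)[OF R]) (use dvd_poly_coeff_cong in blast)
    also have "\<dots> \<le> (real CARD('p) ^ t) ^ e * (1 / real CARD('p) ^ t) ^ Suc d"
      by (intro mult_right_mono card) simp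
    also have "\<dots> = 1 / real CARD('p) ^ (2 * t)"
      using card_pos[where 'p='p]
      by (simp add: e power_one_over field_simps power_mult power2_eq_square flip: power_mult_distrib)
    finally show ?thesis .
  qed
qed

section \<open>Tail bounds at a fixed point and for the supremum\<close>

theorem theorem4p4:
  fixes M :: "'w measure"
    and d :: nat
    and F :: "'w \<Rightarrow> 'p::prime_card padic_int poly"
  assumes "random_padic_poly M d F"
  shows "(\<forall>x. \<forall>s\<ge>0::real.
      {\<omega> \<in> space M. local_condition (F \<omega>) x \<ge> ennreal (real CARD('p) powr s)} \<in> sets M \<and>
      measure M {\<omega> \<in> space M. local_condition (F \<omega>) x \<ge> ennreal (real CARD('p) powr s)}
        \<le> real CARD('p) powr (- 2 * s)) \<and>
    (\<forall>s\<ge>0::real.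
      {\<omega> \<in> space M. global_condition (F \<omega>) \<ge> ennreal (real CARD('p) powr s)} \<in> sets M \<and>
      measure M {\<omega> \<in> space M. global_condition (F \<omega>) \<ge> ennreal (real CARD('p) powr s)}
        \<le> real CARD('p) powr (- s))"
proof (intro conjI allI impI)
  interpret prob_space M using assms by (simp add: random_padic_poly_def)
  define E where "E t x = {\<omega> \<in> space M. near_singular d t x (F \<omega>)}" for t x
  note E = prob_near_singular[OF assms, folded E_def]
  have near: "near_singular d (nat \<lceil>s\<rceil>) x (F \<omega>)"
    if "\<omega> \<in> space M" "ennreal (real CARD('p) powr s) \<le> local_condition (F \<omega>) x" for \<omega> s x
    using that assms
    by (intro near_singular_of_local_condition_ge) (simp_all add: random_padic_poly_def)
  fix s :: real assume s: "0 \<le> s"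
  let ?t = "nat \<lceil>s\<rceil>"
  have le: "1 / real CARD('p) ^ ?t \<le> real CARD('p) powr - s"
    by (rule powr_minus_nat_ceiling_le)
  show "{\<omega> \<in> space M. local_condition (F \<omega>) x \<ge> ennreal (real CARD('p) powr s)} \<in> sets M" for x
    by (rule sets_local_condition_ge[OF assms])
  show "{\<omega> \<in> space M. global_condition (F \<omega>) \<ge> ennreal (real CARD('p) powr s)} \<in> sets M"
    by (rule sets_global_condition_ge[OF assms s])
  show "measure M {\<omega> \<in> space M. local_condition (F \<omega>) x \<ge> ennreal (real CARD('p) powr s)}
        \<le> real CARD('p) powr (- 2 * s)" for x
  proof -
    \<comment> \<open>Squaring p^(-t) <= p^(-s) turns the bound p^(-2t) into p^(-2s).\<close>
    have "measure M {\<omega> \<in> space M. local_condition (F \<omega>) x \<ge> ennreal (real CARD('p) powr s)}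
        \<le> measure M (E ?t x)"
      using near by (intro finite_measure_mono E) (auto simp: E_def)
    also have "\<dots> \<le> (1 / real CARD('p) ^ ?t) * (1 / real CARD('p) ^ ?t)"
      using E(2)[of ?t x] by (simp add: mult_2 power_add)
    also have "\<dots> \<le> real CARD('p) powr - s * real CARD('p) powr - s"
      using le by (intro mult_mono) auto
    also have "\<dots> = real CARD('p) powr (- 2 * s)"
      by (simp flip: powr_add)
    finally show ?thesis .
  qed
  \<comment> \<open>A large global condition number is attained at some x, and x can be replaced by
    its representative below p^t. The union bound then gives p^t * p^(-2t) = p^(-t).\<close>
  let ?Z = "{..<CARD('p) ^ ?t}"
  have "measure M {\<omega> \<in> space M. global_condition (F \<omega>) \<ge> ennreal (real CARD('p) powr s)}
      \<le> measure M (\<Union>z\<in>?Z. E ?t (of_nat z))"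
  proof (intro finite_measure_mono subsetI)
    fix \<omega> assume "\<omega> \<in> {\<omega> \<in> space M. global_condition (F \<omega>) \<ge> ennreal (real CARD('p) powr s)}"
    then obtain x where w: "\<omega> \<in> space M" and "near_singular d ?t x (F \<omega>)"
      using near global_condition_ge_iff[OF s] by blast
    then have "\<omega> \<in> E ?t (of_nat (nat (residue x ?t)))"
      using near_singular_cong[OF residue_of_nat_residue[of x ?t]] by (simp add: E_def)
    moreover have "nat (residue x ?t) \<in> ?Z"
      using residue_nonneg[of x ?t] residue_less[of x ?t]
      by (simp add: nat_less_iff)
    ultimately show "\<omega> \<in> (\<Union>z\<in>?Z. E ?t (of_nat z))" by blast
  qed (use E(1) in auto)
  also have "\<dots> \<le> (\<Sum>z\<in>?Z. measure M (E ?t (of_nat z)))"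
    using E(1) by (intro measure_UNION_le) auto
  also have "\<dots> \<le> (\<Sum>z\<in>?Z. 1 / real CARD('p) ^ (2 * ?t))"
    using E(2) by (intro sum_mono)
  also have "\<dots> = 1 / real CARD('p) ^ ?t"
    using card_pos[where 'p='p] by (simp add: mult_2 power_add)
  also note le
  finally show "measure M {\<omega> \<in> space M. global_condition (F \<omega>) \<ge> ennreal (real CARD('p) powr s)}
        \<le> real CARD('p) powr (- s)" .
qed

end
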